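(* Let $f$ and $g$ be two (formal) power series in the same indeterminate $x$ with coefficients in a commutative ring $R$. Then $$f\ast g=\sum_{k=0}^{\infty}\Big(\big(\overline{\delta_k}\,x^k\big)\odot\big(f^*S_k\big)\odot\big(g^*S_k\big)\Big)'\,S_k,$$ where $f\ast g$ is the convolution (ordinary Cauchy product) of $f$ and $g$, juxtaposition denotes the ordinary product of power series, and the infinite sum is taken coefficientwise in $R[[x]]$.
   Context: Notation. For power series $u=\sum_j u_jx^j$ and $v=\sum_j v_jx^j$, the termwise product is $u\odot v=\sum_j u_jv_jx^j$. Sierpiński triangle: $T_{n,k}\in\{0,1\}$ is the residue of $\binom{n}{k}$ modulo $2$ (read as an integer). Sierpiński's polynomials: $S_m=\sum_{j=0}^m T_{m,j}x^j$. The power series $\delta_k$ is the expansion of $(1-x)^{-1}S_k^{-1}$, i.e. $\delta_k=\dfrac{1}{(1-x)S_k}\in\mathbb Z[[x]]$. Signed Thue–Morse sequence: $\sigma_j=(-1)^{h(j)}$, where $h(j)$ is the number of digits $1$ in the binary expansion of $j\ge 0$. For a power series $u=\sum_j u_jx^j$, $\overline{u}=\sum_j\sigma_ju_jx^j$; in $\overline{\delta_k}\,x^k$ the bar applies to $\delta_k$ only. For a power series $u=\sum_n u_nx^n$, its binomial modulo 2 transform is $u'=\sum_{n\ge0}\Big(\sum_{k=0}^nT_{n,k}u_k\Big)x^n$ and its binomial modulo 2 inverse transform is $u^*=\sum_{n\ge0}\Big(\sum_{k=0}^n\sigma_{n-k}T_{n,k}u_k\Big)x^n$ (the prime does not denote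 a derivative). Integer-coefficient series are regarded as having coefficients in $R$ via the canonical map $\mathbb Z\to R$. *)

theory Defs
  imports "HOL-Computational_Algebra.Formal_Power_Series"
begin

unbundle fps_syntax

definition hadamard :: "'a::times fps \<Rightarrow> 'a fps \<Rightarrow> 'a fps" (infixl \<open>\<odot>\<close> 70) where
  "u \<odot> v = Abs_fps (\<lambda>j. u $ j * v $ j)"

text \<open>The ring homomorphism \<open>\<int>[[x]] \<rightarrow> R[[x]]\<close> induced by the canonical map \<open>\<int> \<rightarrow> R\<close>.\<close>

definition fps_map_of_int :: "int fps \<Rightarrow> 'a::ring_1 fps" where
  "fps_map_of_int u = Abs_fps (\<lambda>n. of_int (u $ n))"

definition sierpinski :: "nat \<Rightarrow> nat \<Rightarrow> int" where
  "sierpinski n k = int (n choose k) mod 2"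

definition sierpinski_poly :: "nat \<Rightarrow> int fps" where
  "sierpinski_poly m = (\<Sum>j\<le>m. fps_const (sierpinski m j) * fps_X ^ j)"

text \<open>
  Division and \<^const>\<open>inverse\<close> of power series are not available over \<open>\<int>\<close>; the inverse in
  \<open>\<int>[[x]]\<close> is written with \<open>fps_right_inverse\<close>, whose second argument is the inverse of the
  constant coefficient, here 1.
\<close>

definition sierpinski_delta :: "nat \<Rightarrow> int fps" where
  "sierpinski_delta k = fps_right_inverse ((1 - fps_X) * sierpinski_poly k) 1"

definition binary_weight :: "nat \<Rightarrow> nat" where
  "binary_weight j = card {i. bit j i}"

definition thue_morse :: "nat \<Rightarrow> int" where
  "thue_morse j = (-1) ^ binary_weight j"

definition fps_bar :: "'a::ring_1 fps \<Rightarrow> 'a fps" where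
  "fps_bar u = Abs_fps (\<lambda>j. of_int (thue_morse j) * u $ j)"

definition binomial2_transform :: "'a::ring_1 fps \<Rightarrow> 'a fps" where
  "binomial2_transform u = Abs_fps (\<lambda>n. \<Sum>k=0..n. of_int (sierpinski n k) * u $ k)"

definition binomial2_inv_transform :: "'a::ring_1 fps \<Rightarrow> 'a fps" where
  "binomial2_inv_transform u =
    Abs_fps (\<lambda>n. \<Sum>k=0..n. of_int (thue_morse (n - k) * sierpinski n k) * u $ k)"

lemma sierpinski_poly_nth_0: "sierpinski_poly m $ 0 = 1"
  by (simp add: sierpinski_poly_def sierpinski_def fps_sum_nth fps_X_power_iff
      if_distrib[of "\<lambda>x. _ * x"] cong: if_cong)

lemma sierpinski_delta_inverse:
  "((1 - fps_X) * sierpinski_poly k) * sierpinski_delta k = 1"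
  unfolding sierpinski_delta_def
  by (rule fps_right_inverse) (simp add: sierpinski_poly_nth_0)

end

theory Submission
  imports Defs "HOL-Library.Nat_Bijection"
begin

text \<open>
  Both sides are bilinear in the inverse transforms of \<open>f\<close> and \<open>g\<close>, so the identity is checked on
  pairs of basis elements. Identify a natural number with the set of its binary digits. By Lucas,
  \<open>T n k = 1\<close> exactly if \<open>k \<subseteq> n\<close>; hence \<open>S_n\<close> is the product of \<open>1 + x^(2^b)\<close> over the digits \<open>b\<close>
  of \<open>n\<close>, and the transform of \<open>x^n\<close> is \<open>U_n\<close>, the sum of all \<open>x^m\<close> with \<open>n \<subseteq> m\<close>. Both
  are multiplicative over digits, which gives \<open>(1 - x) S_n U_n = x^n\<close>, that is \<open>U_n = x^n \<delta>_n\<close>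
  (lemmas \<open>superset_series_mult_subset_poly\<close>, \<open>X_power_mult_sierpinski_delta\<close>). Since
  \<open>i + j = (i \<inter> j) + (i \<union> j)\<close> and \<open>S_i S_j = S_(i \<inter> j) S_(i \<union> j)\<close>, it follows that
  \<open>U_i U_j = U_(i \<inter> j) U_(i \<union> j)\<close> (\<open>superset_series_mult\<close>).

  By \<open>U_k = x^k \<delta>_k\<close>, the coefficient of \<open>x^n\<close> in \<open>(\<delta>_k with a bar) x^k\<close> is \<open>\<sigma>_(n - k)\<close> if
  \<open>k \<subseteq> n\<close> and 0 otherwise. For \<open>k \<subseteq> n\<close> the coefficient of \<open>x^n\<close> in \<open>x^i S_k\<close> is 1 exactly if
  \<open>i \<subseteq> n\<close> and \<open>n - i \<subseteq> k\<close>: no carries occur. So for \<open>f^* = x^i\<close> and \<open>g^* = x^j\<close>, with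
  \<open>l = i \<inter> j\<close>, the right-hand side is the sum over \<open>n \<supseteq> i \<union> j\<close> of \<open>U_n\<close> times the alternating
  sum of \<open>\<sigma>_(n - k) S_k\<close> over the interval \<open>n - l \<subseteq> k \<subseteq> n\<close>. That alternating sum factors over the
  digits of \<open>l\<close>, each contributing \<open>(1 + x^(2^b)) - 1\<close>, and equals \<open>S_(n - l) x^l\<close>. As
  \<open>U_n S_(n - l) x^l = x^n U_l\<close>, the sum over \<open>n\<close> is \<open>U_(i \<union> j) U_l = U_i U_j\<close>, which is the left-hand
  side (\<open>sum_kernel_weight_subset_poly\<close>, \<open>sum_kernel_weight\<close>).

  To keep all sums finite, the argument fixes a coefficient \<open>N\<close>: the indices \<open>i\<close>, \<open>j\<close> and \<open>n\<close>
  matter only up to \<open>N\<close>, and the partial sums over \<open>k\<close> are constant from \<open>N\<close> on.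
\<close>

section \<open>Binary expansions and finite sets\<close>

lemma set_encode_Diff:
  assumes "A \<subseteq> B" "finite B"
  shows "set_encode (B - A) = set_encode B - set_encode A"
  using sum.subset_diff[OF assms, of "\<lambda>b. 2 ^ b :: nat"] by (simp add: set_encode_def)

lemma set_encode_mono: "A \<subseteq> B \<Longrightarrow> finite B \<Longrightarrow> set_encode A \<le> set_encode B"
  unfolding set_encode_def by (rule sum_mono2) auto

lemma set_decode_diff:
  assumes "set_decode k \<subseteq> set_decode n"
  shows "set_decode (n - k) = set_decode n - set_decode k"
  using set_encode_Diff[OF assms] set_encode_inverse[of "set_decode n - set_decode k"] by simp

text \<open>
  Here \<open>k\<close> is not assumed to be a submask of \<open>n\<close>, so \<open>n - k\<close> is a subtraction that may borrow. If
  its result is a submask of \<open>n\<close>, then subtracting it from \<open>n\<close> in turn is borrow-free and returns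
  \<open>k\<close>. This is what removes all carries from products such as \<open>x^i S_k\<close>.
\<close>

lemma set_decode_diff_subset_iff:
  "k \<le> n \<and> set_decode (n - k) \<subseteq> set_decode n \<longleftrightarrow> set_decode k \<subseteq> set_decode n"
proof
  assume *: "k \<le> n \<and> set_decode (n - k) \<subseteq> set_decode n"
  then have "set_decode (n - (n - k)) \<subseteq> set_decode n"
    using set_decode_diff[of "n - k" n] by blast
  with * show "set_decode k \<subseteq> set_decode n" by simp
next
  assume "set_decode k \<subseteq> set_decode n"
  then show "k \<le> n \<and> set_decode (n - k) \<subseteq> set_decode n"
    using set_decode_diff[of k n] subset_decode_imp_le by blast
qed

text \<open>
  This moves sums over numbers between two bit masks to sums over a power set, where
  \<open>prod_add\<close> applies.
\<close>

lemma sum_decode_interval: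
  fixes h :: "nat set \<Rightarrow> 'b::comm_monoid_add"
  assumes "A \<subseteq> B" "finite B" "set_encode B \<le> N"
  shows "(\<Sum>k\<le>N. if A \<subseteq> set_decode k \<and> set_decode k \<subseteq> B then h (set_decode k) else 0)
       = (\<Sum>C\<in>Pow (B - A). h (A \<union> C))"
proof -
  have le: "k \<le> N" if "set_decode k \<subseteq> B" for k
    using set_encode_mono[OF that assms(2)] assms(3) by simp
  have "(\<Sum>k\<le>N. if A \<subseteq> set_decode k \<and> set_decode k \<subseteq> B then h (set_decode k) else 0)
      = (\<Sum>k\<in>{k. A \<subseteq> set_decode k \<and> set_decode k \<subseteq> B}. h (set_decode k))"
    by (rule sum.mono_neutral_cong_right) (use le in auto)
  also have "\<dots> = (\<Sum>C\<in>Pow (B - A). h (A \<union> C))"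
  proof (rule sum.reindex_bij_witness[of _ "\<lambda>C. set_encode (A \<union> C)" "\<lambda>k. set_decode k - A"])
    fix C assume "C \<in> Pow (B - A)"
    moreover have "finite (A \<union> C)"
      using calculation assms by (auto intro: finite_subset)
    ultimately show "set_decode (set_encode (A \<union> C)) - A = C"
      "set_encode (A \<union> C) \<in> {k. A \<subseteq> set_decode k \<and> set_decode k \<subseteq> B}"
      using assms(1) by auto
  qed (auto simp: Un_absorb1 Un_commute)
  finally show ?thesis .
qed

lemma thue_morse_set_decode: "thue_morse n = (-1) ^ card (set_decode n)"
  by (simp add: thue_morse_def binary_weight_def set_decode_def bit_iff_odd)

lemma set_decode_subset_iff:
  "set_decode k \<subseteq> set_decode n \<longleftrightarrow>
     (odd k \<longrightarrow> odd n) \<and> set_decode (k div 2) \<subseteq> set_decode (n div 2)"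
proof -
  have "set_decode k \<subseteq> set_decode n \<longleftrightarrow>
      (\<forall>b. b \<in> set_decode k \<longrightarrow> b \<in> set_decode n)"
    by blast
  also have "\<dots> \<longleftrightarrow> (0 \<in> set_decode k \<longrightarrow> 0 \<in> set_decode n) \<and>
      (\<forall>b. Suc b \<in> set_decode k \<longrightarrow> Suc b \<in> set_decode n)"
    by (metis not0_implies_Suc)
  also have "\<dots> \<longleftrightarrow> (odd k \<longrightarrow> odd n) \<and> set_decode (k div 2) \<subseteq> set_decode (n div 2)"
    by auto
  finally show ?thesis .
qed

lemma set_decode_subset_double:
  "set_decode (2 * k) \<subseteq> set_decode (2 * n) \<longleftrightarrow> set_decode k \<subseteq> set_decode n"
  "set_decode (2 * k) \<subseteq> set_decode (Suc (2 * n)) \<longleftrightarrow> set_decode k \<subseteq> set_decode n"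
  "set_decode (Suc (2 * k)) \<subseteq> set_decode (Suc (2 * n)) \<longleftrightarrow> set_decode k \<subseteq> set_decode n"
  "\<not> set_decode (Suc (2 * k)) \<subseteq> set_decode (2 * n)"
  by (subst set_decode_subset_iff; simp)+

text \<open>
  Pascal's rule modulo 2 for the relation of digit inclusion; the exclusive or is addition modulo 2.
\<close>

lemma set_decode_subset_Suc_Suc:
  "set_decode (Suc k) \<subseteq> set_decode (Suc n) \<longleftrightarrow>
     (set_decode k \<subseteq> set_decode n) \<noteq> (set_decode (Suc k) \<subseteq> set_decode n)"
proof (induction n arbitrary: k rule: less_induct)
  case (less n)
  have Suc_Suc: "Suc (Suc (2 * m)) = 2 * Suc m" for m by simp
  show ?case
  proof (cases "even n")
    case True
    then obtain m where n: "n = 2 * m" by blast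
    show ?thesis
    proof (cases "even k")
      case True
      then obtain l where "k = 2 * l" by blast
      with n show ?thesis by (simp add: set_decode_subset_double)
    next
      case False
      then obtain l where "k = Suc (2 * l)" using oddE by fastforce
      with n show ?thesis by (simp add: set_decode_subset_double Suc_Suc del: mult_Suc_right)
    qed
  next
    case False
    then obtain m where n: "n = Suc (2 * m)" using oddE by fastforce
    show ?thesis
    proof (cases "even k")
      case True
      then obtain l where "k = 2 * l" by blast
      with n show ?thesis by (simp add: set_decode_subset_double Suc_Suc del: mult_Suc_right)
    next
      case False
      then obtain l where "k = Suc (2 * l)" using oddE by fastforce
      with n less.IH[of m l] show ?thesis
        by (simp add: set_decode_subset_double Suc_Suc del: mult_Suc_right)
    qed
  qed
qed

text \<open>
  The case of the prime 2 of Lucas's theorem: both sides satisfy Pascal's recursion modulo 2.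
\<close>

lemma odd_binomial_iff: "odd (n choose k) \<longleftrightarrow> set_decode k \<subseteq> set_decode n"
proof (induction n arbitrary: k)
  case 0
  have "set_decode k = {} \<longleftrightarrow> k = 0"
    by (metis set_decode_inverse set_decode_zero)
  then show ?case by (cases k) auto
next
  case (Suc n)
  then show ?case
    by (cases k) (auto simp: set_decode_subset_Suc_Suc)
qed

lemma sierpinski_eq: "sierpinski n k = of_bool (set_decode k \<subseteq> set_decode n)"
  unfolding sierpinski_def odd_binomial_iff[symmetric]
  by (simp add: mod2_eq_if)

section \<open>The Sierpinski polynomials and the series of the supersets\<close>

text \<open>
  Both families are indexed by sets rather than numbers, so that unions and intersections of digit
  sets can be formed freely.
\<close>

definition subset_poly :: "nat set \<Rightarrow> int fps" where
  "subset_poly A = (\<Prod>b\<in>A. 1 + fps_X ^ (2 ^ b))"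

definition superset_series :: "nat set \<Rightarrow> int fps" where
  "superset_series A = Abs_fps (\<lambda>n. of_bool (A \<subseteq> set_decode n))"

lemma superset_series_nth: "superset_series A $ n = of_bool (A \<subseteq> set_decode n)"
  by (simp add: superset_series_def)

lemma prod_X_power: "(\<Prod>b\<in>A. fps_X ^ (2 ^ b)) = (fps_X :: int fps) ^ set_encode A"
  by (simp add: set_encode_def power_sum)

lemma subset_poly_nth:
  assumes "finite A"
  shows "subset_poly A $ j = of_bool (set_decode j \<subseteq> A)"
proof -
  have "subset_poly A = (\<Sum>B\<in>Pow A. fps_X ^ set_encode (A - B))"
    unfolding subset_poly_def prod_add[OF assms] by (simp add: prod_X_power)
  also have "\<dots> = (\<Sum>B\<in>Pow A. fps_X ^ set_encode B)"
    by (rule sum.reindex_bij_witness[of _ "\<lambda>B. A - B" "\<lambda>B. A - B"]) auto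
  finally have "subset_poly A $ j = (\<Sum>B\<in>Pow A. of_bool (j = set_encode B))"
    by (simp add: fps_sum_nth fps_X_power_iff of_bool_def)
  also have "\<dots> = (\<Sum>B\<in>Pow A. if B = set_decode j then 1 else 0)"
    using assms by (intro sum.cong) (auto simp: of_bool_def dest: finite_subset)
  also have "\<dots> = of_bool (set_decode j \<subseteq> A)"
    using assms by simp
  finally show ?thesis .
qed

lemma sierpinski_poly_nth:
  "sierpinski_poly m $ j = of_bool (set_decode j \<subseteq> set_decode m)"
proof -
  have "sierpinski_poly m $ j = (if j \<le> m then sierpinski m j else 0)"
    by (simp add: sierpinski_poly_def fps_sum_nth fps_X_power_iff if_distrib cong: if_cong)
  then show ?thesis
    using subset_decode_imp_le[of j m] by (auto simp: sierpinski_eq)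
qed

lemma sierpinski_poly_eq: "sierpinski_poly m = subset_poly (set_decode m)"
  by (simp add: fps_eq_iff sierpinski_poly_nth subset_poly_nth)

lemma subset_poly_Un_disjoint:
  "finite A \<Longrightarrow> finite B \<Longrightarrow> A \<inter> B = {} \<Longrightarrow>
     subset_poly (A \<union> B) = subset_poly A * subset_poly B"
  by (simp add: subset_poly_def prod.union_disjoint)

lemma subset_poly_nonzero: "subset_poly A \<noteq> 0"
proof (cases "finite A")
  case True
  then have "subset_poly A $ 0 = 1" by (simp add: subset_poly_nth)
  then show ?thesis by force
qed (simp add: subset_poly_def)

lemma one_minus_X_nonzero: "(1 - fps_X :: int fps) \<noteq> 0"
proof
  assume "(1 - fps_X :: int fps) = 0"
  then have "(1 - fps_X :: int fps) $ 0 = 0" by simp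
  then show False by simp
qed

lemma set_decode_add_power_2_remove:
  assumes "b \<in> set_decode n"
  shows "b \<notin> set_decode (n + 2 ^ b)"
  using assms by (simp add: set_decode_def)

text \<open>
  Writing an exponent \<open>m \<ge> 2^b\<close> as \<open>n + 2^b\<close>, exactly one of \<open>n\<close> and \<open>m\<close> contains the digit
  \<open>b\<close>. If \<open>n\<close> does, the left-hand side sees it through the shifted copy of the series; if not,
  the addition is carry-free and it sees \<open>m\<close> itself.
\<close>

lemma superset_series_insert:
  assumes "b \<notin> A"
  shows "(1 + fps_X ^ (2 ^ b)) * superset_series (insert b A) = fps_X ^ (2 ^ b) * superset_series A"
proof (rule fps_ext)
  fix m
  show "((1 + fps_X ^ (2 ^ b)) * superset_series (insert b A)) $ m
      = (fps_X ^ (2 ^ b) * superset_series A) $ m"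
  proof (cases "m < 2 ^ b")
    case True
    then have "b \<notin> set_decode m" by (simp add: set_decode_def)
    with True show ?thesis
      by (simp add: distrib_right fps_X_power_mult_nth superset_series_def)
  next
    case False
    then obtain n where m: "m = 2 ^ b + n"
      using le_Suc_ex not_less by blast
    show ?thesis
    proof (cases "b \<in> set_decode n")
      case True
      then have "b \<notin> set_decode m"
        using set_decode_add_power_2_remove m by (simp add: add.commute)
      with True m show ?thesis
        by (simp add: distrib_right fps_X_power_mult_nth superset_series_def)
    next
      case False
      then have "set_decode m = insert b (set_decode n)"
        using set_decode_plus_power_2 m by simp
      with False m assms show ?thesis
        by (auto simp: distrib_right fps_X_power_mult_nth superset_series_def)
    qed
  qed
qed

text \<open>
  Combinatorially, \<open>1 / (1 - x)\<close> is the product of \<open>1 + x^(2^b)\<close> over all \<open>b\<close>; demanding the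
  digits in \<open>A\<close> replaces the factors at \<open>A\<close> by \<open>x^(2^b)\<close>. The digits are forced one at a time.
\<close>

lemma superset_series_mult_subset_poly:
  assumes "finite A"
  shows "(1 - fps_X) * subset_poly A * superset_series A = fps_X ^ set_encode A"
  using assms
proof (induction A)
  case empty
  have "(1 - fps_X) * superset_series {} = 1"
    by (rule fps_ext) (simp add: left_diff_distrib superset_series_def fps_X_mult_nth)
  then show ?case by (simp add: subset_poly_def)
next
  case (insert b A)
  have "(1 - fps_X) * subset_poly (insert b A) * superset_series (insert b A)
      = (1 - fps_X) * subset_poly A * ((1 + fps_X ^ (2 ^ b)) * superset_series (insert b A))"
    using insert.hyps by (simp add: subset_poly_def mult_ac)
  also have "\<dots> = fps_X ^ (2 ^ b) * ((1 - fps_X) * subset_poly A * superset_series A)"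
    using insert.hyps by (subst superset_series_insert) (simp_all add: mult_ac)
  also have "\<dots> = fps_X ^ set_encode (insert b A)"
    using insert by (simp add: power_add)
  finally show ?case .
qed

lemma X_power_mult_sierpinski_delta:
  "fps_X ^ k * sierpinski_delta k = superset_series (set_decode k)"
proof -
  let ?D = "(1 - fps_X) * subset_poly (set_decode k)"
  have "?D * superset_series (set_decode k) = fps_X ^ k"
    using superset_series_mult_subset_poly[of "set_decode k"] by simp
  moreover have "?D * sierpinski_delta k = 1"
    using sierpinski_delta_inverse[of k] by (simp add: sierpinski_poly_eq)
  ultimately show ?thesis
    by (metis mult.assoc mult.commute mult_1)
qed

lemma sierpinski_delta_nth:
  "k \<le> n \<Longrightarrow> sierpinski_delta k $ (n - k) = of_bool (set_decode k \<subseteq> set_decode n)"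
  using arg_cong[OF X_power_mult_sierpinski_delta[of k], of "\<lambda>u. u $ n"]
  by (simp add: fps_X_power_mult_nth superset_series_def)

text \<open>
  After multiplication by \<open>(1 - x) S_L\<close>, both sides become \<open>x^L x^M\<close>, because
  \<open>S_M = S_L S_(M - L)\<close>.
\<close>

lemma superset_series_mult_subset_poly_Diff:
  assumes "L \<subseteq> M" "finite M"
  shows "superset_series M * subset_poly (M - L) * fps_X ^ set_encode L
       = fps_X ^ set_encode M * superset_series L"
proof -
  have fin: "finite L" using assms finite_subset by blast
  let ?D = "(1 - fps_X) * subset_poly L"
  have M: "subset_poly M = subset_poly L * subset_poly (M - L)"
    using subset_poly_Un_disjoint[of L "M - L"] assms fin by (simp add: Un_absorb1)
  have "?D * (superset_series M * subset_poly (M - L) * fps_X ^ set_encode L)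
      = fps_X ^ set_encode L * ((1 - fps_X) * subset_poly M * superset_series M)"
    by (simp add: M mult_ac)
  also have "\<dots> = fps_X ^ set_encode M * (?D * superset_series L)"
    unfolding superset_series_mult_subset_poly[OF assms(2)] superset_series_mult_subset_poly[OF fin]
    by (rule mult.commute)
  finally have "?D * (superset_series M * subset_poly (M - L) * fps_X ^ set_encode L)
      = ?D * (fps_X ^ set_encode M * superset_series L)"
    by (simp add: mult_ac)
  then show ?thesis
    using one_minus_X_nonzero subset_poly_nonzero by simp
qed

text \<open>
  Union and intersection preserve the total number of occurrences of each digit, so the
  denominators and the monomials of the two sides agree.
\<close>

lemma superset_series_mult:
  assumes "finite A" "finite B"
  shows "superset_series A * superset_series B = superset_series (A \<inter> B) * superset_series (A \<union> B)"
proof -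
  have enc: "set_encode A + set_encode B = set_encode (A \<inter> B) + set_encode (A \<union> B)"
    unfolding set_encode_def using sum.union_inter[OF assms, of "\<lambda>b. 2 ^ b :: nat"] by simp
  have poly: "subset_poly A * subset_poly B = subset_poly (A \<inter> B) * subset_poly (A \<union> B)"
    unfolding subset_poly_def using prod.union_inter[OF assms, of "\<lambda>b. 1 + fps_X ^ (2 ^ b) :: int fps"] 
    by (simp add: mult.commute)
  let ?D = "\<lambda>A. (1 - fps_X) * subset_poly A"
  have D: "?D A * ?D B = ?D (A \<inter> B) * ?D (A \<union> B)"
    using poly by (simp add: mult_ac)
  have "?D A * ?D B * (superset_series A * superset_series B)
      = (?D A * superset_series A) * (?D B * superset_series B)"
    by (simp add: mult_ac)
  also have "\<dots> = (?D (A \<inter> B) * superset_series (A \<inter> B)) * (?D (A \<union> B) * superset_series (A \<union> B))"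
    using assms by (simp add: superset_series_mult_subset_poly power_add[symmetric] enc)
  also have "\<dots> = ?D A * ?D B * (superset_series (A \<inter> B) * superset_series (A \<union> B))"
    unfolding D by (simp add: mult_ac)
  finally show ?thesis
    using one_minus_X_nonzero subset_poly_nonzero by simp
qed

section \<open>Alternating sums over intervals of sets\<close>

text \<open>
  The common factor \<open>S_(M - L)\<close> splits off, and the remaining sum over subsets of \<open>L\<close> is the
  expansion of the product of \<open>(1 + x^(2^b)) - 1\<close> over \<open>b \<in> L\<close>.
\<close>

lemma alternating_sum_subset_poly:
  assumes "L \<subseteq> M" "finite M"
  shows "(\<Sum>C\<in>Pow L. (-1) ^ card (M - (M - L \<union> C)) * subset_poly (M - L \<union> C))
       = subset_poly (M - L) * fps_X ^ set_encode L"
proof -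
  have fin: "finite L" using assms finite_subset by blast
  have "(\<Sum>C\<in>Pow L. (-1) ^ card (M - (M - L \<union> C)) * subset_poly (M - L \<union> C))
      = (\<Sum>C\<in>Pow L. subset_poly (M - L) * (subset_poly C * (-1) ^ card (L - C)))"
  proof (rule sum.cong[OF refl])
    fix C assume C: "C \<in> Pow L"
    then have "M - (M - L \<union> C) = L - C" using assms by blast
    moreover have "subset_poly (M - L \<union> C) = subset_poly (M - L) * subset_poly C"
      using C assms fin by (intro subset_poly_Un_disjoint) (auto intro: finite_subset)
    ultimately show "(-1) ^ card (M - (M - L \<union> C)) * subset_poly (M - L \<union> C)
        = subset_poly (M - L) * (subset_poly C * (-1) ^ card (L - C))"
      by (simp add: mult_ac)
  qed
  also have "\<dots> = subset_poly (M - L) * (\<Prod>b\<in>L. (1 + fps_X ^ (2 ^ b)) + (-1))"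
    unfolding prod_add[OF fin] by (simp add: subset_poly_def sum_distrib_left)
  also have "\<dots> = subset_poly (M - L) * fps_X ^ set_encode L"
    by (simp add: prod_X_power)
  finally show ?thesis .
qed

lemma alternating_sum_Pow:
  assumes "finite A"
  shows "(\<Sum>C\<in>Pow A. (-1) ^ card C) = (of_bool (A = {}) :: int)"
proof -
  have "(\<Sum>C\<in>Pow A. (-1) ^ card C) = (\<Prod>b\<in>A. (-1) + (1::int))"
    unfolding prod_add[OF assms] by simp
  then show ?thesis using assms by (simp add: zero_power card_gt_0_iff)
qed

section \<open>Coefficients of the transforms\<close>

text \<open>
  The transform sends \<open>x^k\<close> to the superset series of \<open>k\<close>. The range is extended to a common bound
  \<open>N\<close>, independent of \<open>n\<close>, so that sums over different coefficients can be interchanged.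
\<close>

lemma fps_nth_binomial2_transform:
  assumes "n \<le> N"
  shows "binomial2_transform u $ n
       = (\<Sum>k\<le>N. of_int (superset_series (set_decode k) $ n) * u $ k)"
  unfolding binomial2_transform_def superset_series_def sierpinski_eq fps_nth_Abs_fps
  by (rule sum.mono_neutral_left) (use assms subset_decode_imp_le in fastforce)+

text \<open>
  Moebius inversion on the lattice of digit sets: the coefficient of \<open>f_j\<close> in the \<open>n\<close>-th
  coefficient is the alternating sum over the interval from \<open>j\<close> to \<open>n\<close>, which vanishes unless the
  interval is a single point.
\<close>

lemma binomial2_transform_inv_transform:
  fixes f :: "'a::comm_ring_1 fps"
  shows "binomial2_transform (binomial2_inv_transform f) = f"
proof (rule fps_ext)
  fix n
  let ?d = set_decode
  have inv: "binomial2_inv_transform f $ k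
      = (\<Sum>j\<le>n. of_int (of_bool (?d j \<subseteq> ?d k) * (-1) ^ card (?d k - ?d j)) * f $ j)"
    if "k \<le> n" for k
    unfolding binomial2_inv_transform_def fps_nth_Abs_fps
  proof (rule sum.mono_neutral_cong_left)
    show "\<forall>j\<in>{..n} - {0..k}.
        of_int (of_bool (?d j \<subseteq> ?d k) * (-1) ^ card (?d k - ?d j)) * f $ j = 0"
      using subset_decode_imp_le by fastforce
  qed (use that in \<open>auto simp: sierpinski_eq thue_morse_set_decode set_decode_diff\<close>)
  have "binomial2_transform (binomial2_inv_transform f) $ n
      = (\<Sum>k\<le>n. \<Sum>j\<le>n. of_int (if ?d j \<subseteq> ?d k \<and> ?d k \<subseteq> ?d n then (-1) ^ card (?d k - ?d j) else 0) * f $ j)"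
    unfolding fps_nth_binomial2_transform[OF order_refl]
  proof (rule sum.cong[OF refl])
    fix k assume "k \<in> {..n}"
    then have k: "k \<le> n" by simp
    show "of_int (superset_series (?d k) $ n) * binomial2_inv_transform f $ k
        = (\<Sum>j\<le>n. of_int (if ?d j \<subseteq> ?d k \<and> ?d k \<subseteq> ?d n then (-1) ^ card (?d k - ?d j) else 0) * f $ j)"
      unfolding inv[OF k] sum_distrib_left
      by (intro sum.cong refl) (simp add: superset_series_def)
  qed
  also have "\<dots> = (\<Sum>j\<le>n. of_int (\<Sum>k\<le>n. if ?d j \<subseteq> ?d k \<and> ?d k \<subseteq> ?d n then (-1) ^ card (?d k - ?d j) else 0) * f $ j)"
    unfolding of_int_sum sum_distrib_right by (rule sum.swap)
  also have "\<dots> = (\<Sum>j\<le>n. if j = n then f $ j else 0)"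
  proof (rule sum.cong[OF refl])
    fix j assume "j \<in> {..n}"
    have "(\<Sum>k\<le>n. if ?d j \<subseteq> ?d k \<and> ?d k \<subseteq> ?d n then (-1) ^ card (?d k - ?d j) else 0)
        = (of_bool (j = n) :: int)"
    proof (cases "?d j \<subseteq> ?d n")
      case True
      have "(\<Sum>k\<le>n. if ?d j \<subseteq> ?d k \<and> ?d k \<subseteq> ?d n then (-1) ^ card (?d k - ?d j) else (0::int))
          = (\<Sum>C\<in>Pow (?d n - ?d j). (-1) ^ card (?d j \<union> C - ?d j))"
        by (rule sum_decode_interval[OF True]) simp_all
      also have "\<dots> = (\<Sum>C\<in>Pow (?d n - ?d j). (-1) ^ card C)"
      proof (rule sum.cong[OF refl])
        fix C assume "C \<in> Pow (?d n - ?d j)"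
        then have "?d j \<union> C - ?d j = C" by blast
        then show "(-1) ^ card (?d j \<union> C - ?d j) = (-1 :: int) ^ card C" by simp
      qed
      also have "\<dots> = of_bool (?d n - ?d j = {})"
        by (rule alternating_sum_Pow) simp
      also have "?d n - ?d j = {} \<longleftrightarrow> j = n"
        using True by (metis Diff_eq_empty_iff order_refl set_decode_inverse subset_antisym)
      finally show ?thesis .
    next
      case False
      then have "j \<noteq> n" and "\<not> (?d j \<subseteq> ?d k \<and> ?d k \<subseteq> ?d n)" for k by auto
      then show ?thesis by (auto intro!: sum.neutral)
    qed
    then show "of_int (\<Sum>k\<le>n. if ?d j \<subseteq> ?d k \<and> ?d k \<subseteq> ?d n then (-1) ^ card (?d k - ?d j) else 0) * f $ j
        = (if j = n then f $ j else 0)"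
      by (simp del: of_int_sum)
  qed
  finally show "binomial2_transform (binomial2_inv_transform f) $ n = f $ n" by simp
qed

lemma fps_nth_binomial2_transform_mult:
  fixes u :: "'a::comm_ring_1 fps"
  shows "(binomial2_transform u * fps_map_of_int p) $ N
       = (\<Sum>n\<le>N. u $ n * of_int ((superset_series (set_decode n) * p) $ N))"
proof -
  have "(binomial2_transform u * fps_map_of_int p) $ N
      = (\<Sum>m=0..N. \<Sum>n\<le>N. u $ n * of_int (superset_series (set_decode n) $ m * p $ (N - m)))"
    unfolding fps_mult_nth
    by (intro sum.cong refl)
       (simp add: fps_nth_binomial2_transform[of _ N] fps_map_of_int_def sum_distrib_right sum_distrib_left mult_ac)
  also have "\<dots> = (\<Sum>n\<le>N. u $ n * of_int ((superset_series (set_decode n) * p) $ N))"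
    by (subst sum.swap) (simp add: fps_mult_nth sum_distrib_left)
  finally show ?thesis .
qed

lemma fps_nth_binomial2_transform_mult_transform:
  fixes u v :: "'a::comm_ring_1 fps"
  shows "(binomial2_transform u * binomial2_transform v) $ N
       = (\<Sum>i\<le>N. \<Sum>j\<le>N. u $ i * v $ j *
            of_int ((superset_series (set_decode i) * superset_series (set_decode j)) $ N))"
proof -
  have "(binomial2_transform u * binomial2_transform v) $ N
      = (\<Sum>m=0..N. \<Sum>i\<le>N. \<Sum>j\<le>N. u $ i * v $ j *
           of_int (superset_series (set_decode i) $ m * superset_series (set_decode j) $ (N - m)))"
    unfolding fps_mult_nth
    by (intro sum.cong refl)
       (simp add: fps_nth_binomial2_transform[of _ N] sum_product mult_ac)
  also have "\<dots> = (\<Sum>i\<le>N. \<Sum>m=0..N. \<Sum>j\<le>N. u $ i * v $ j *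
           of_int (superset_series (set_decode i) $ m * superset_series (set_decode j) $ (N - m)))"
    by (rule sum.swap)
  also have "\<dots> = (\<Sum>i\<le>N. \<Sum>j\<le>N. \<Sum>m=0..N. u $ i * v $ j *
           of_int (superset_series (set_decode i) $ m * superset_series (set_decode j) $ (N - m)))"
    by (intro sum.cong refl sum.swap)
  also have "\<dots> = (\<Sum>i\<le>N. \<Sum>j\<le>N. u $ i * v $ j *
            of_int ((superset_series (set_decode i) * superset_series (set_decode j)) $ N))"
    by (simp add: fps_mult_nth sum_distrib_left)
  finally show ?thesis .
qed

lemma fps_nth_mult_sierpinski_poly:
  assumes "n \<le> N"
  shows "(u * fps_map_of_int (sierpinski_poly k)) $ n
       = (\<Sum>i\<le>N. u $ i * of_int (of_bool (i \<le> n \<and> set_decode (n - i) \<subseteq> set_decode k)))"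
  unfolding fps_mult_nth
  by (rule sum.mono_neutral_cong_left)
     (use assms in \<open>auto simp: fps_map_of_int_def sierpinski_poly_nth\<close>)

section \<open>The convolution formula\<close>

text \<open>
  The coefficient of \<open>x^n\<close> in the \<open>k\<close>-th termwise product, when the inverse transforms of the two
  series are \<open>x^i\<close> and \<open>x^j\<close>. The sign is \<open>\<sigma>_(n - k)\<close>, written through digit sets.
\<close>

definition kernel_weight :: "nat \<Rightarrow> nat \<Rightarrow> nat \<Rightarrow> nat \<Rightarrow> int" where
  "kernel_weight i j n k =
     of_bool (set_decode k \<subseteq> set_decode n) * (-1) ^ card (set_decode n - set_decode k)
     * of_bool (i \<le> n \<and> set_decode (n - i) \<subseteq> set_decode k)
     * of_bool (j \<le> n \<and> set_decode (n - j) \<subseteq> set_decode k)"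

text \<open>
  For fixed \<open>i\<close>, \<open>j\<close> and \<open>n\<close>, the indices \<open>k\<close> of non-zero weight, if there are any, form the
  interval of digit sets between \<open>n - (i \<inter> j)\<close> and \<open>n\<close>, since \<open>n - i\<close> and \<open>n - j\<close> have union \<open>n - (i \<inter> j)\<close>.
\<close>

lemma kernel_weight_eq:
  "kernel_weight i j n k =
     (if set_decode i \<union> set_decode j \<subseteq> set_decode n
         \<and> set_decode n - set_decode i \<inter> set_decode j \<subseteq> set_decode k
         \<and> set_decode k \<subseteq> set_decode n
      then (-1) ^ card (set_decode n - set_decode k) else 0)"
proof (cases "set_decode k \<subseteq> set_decode n")
  case True
  have "a \<le> n \<and> set_decode (n - a) \<subseteq> set_decode k \<longleftrightarrow>
      set_decode a \<subseteq> set_decode n \<and> set_decode n - set_decode a \<subseteq> set_decode k" for a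
    using set_decode_diff_subset_iff[of a n] set_decode_diff[of a n] True by blast
  with True show ?thesis
    unfolding kernel_weight_def by auto
qed (simp add: kernel_weight_def)

lemma sum_kernel_weight_subset_poly:
  assumes "n \<le> K"
  shows "superset_series (set_decode n) *
           (\<Sum>k\<le>K. fps_const (kernel_weight i j n k) * sierpinski_poly k)
       = of_bool (set_decode i \<union> set_decode j \<subseteq> set_decode n) *
           (fps_X ^ n * superset_series (set_decode i \<inter> set_decode j))"
proof (cases "set_decode i \<union> set_decode j \<subseteq> set_decode n")
  case True
  let ?M = "set_decode n" and ?L = "set_decode i \<inter> set_decode j"
  have L: "?L \<subseteq> ?M" using True by blast
  have "(\<Sum>k\<le>K. fps_const (kernel_weight i j n k) * sierpinski_poly k)
      = (\<Sum>k\<le>K. if ?M - ?L \<subseteq> set_decode k \<and> set_decode k \<subseteq> ?M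
           then (-1) ^ card (?M - set_decode k) * subset_poly (set_decode k) else 0)"
    using True by (intro sum.cong refl)
      (simp add: kernel_weight_eq sierpinski_poly_eq fps_const_power[symmetric] fps_const_neg[symmetric]
         del: fps_const_power fps_const_neg)
  also have "\<dots> = (\<Sum>C\<in>Pow (?M - (?M - ?L)).
      (-1) ^ card (?M - (?M - ?L \<union> C)) * subset_poly (?M - ?L \<union> C))"
    by (rule sum_decode_interval) (use assms in auto)
  also have "?M - (?M - ?L) = ?L" using L by blast
  also have "(\<Sum>C\<in>Pow ?L. (-1) ^ card (?M - (?M - ?L \<union> C)) * subset_poly (?M - ?L \<union> C))
      = subset_poly (?M - ?L) * fps_X ^ set_encode ?L"
    by (rule alternating_sum_subset_poly[OF L]) simp
  finally show ?thesis
    using True superset_series_mult_subset_poly_Diff[OF L]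
    by (simp add: mult.assoc)
next
  case False
  then have "kernel_weight i j n k = 0" for k
    by (auto simp: kernel_weight_eq)
  then show ?thesis by (simp only: False) simp
qed

text \<open>
  The theorem on a pair of basis elements. Summation over \<open>k\<close> leaves \<open>x^n U_(i \<inter> j)\<close> for each
  \<open>n \<supseteq> i \<union> j\<close>; these \<open>x^n\<close> are the terms of \<open>U_(i \<union> j)\<close>, so the sum over \<open>n\<close> is a Cauchy product.
\<close>

lemma sum_kernel_weight:
  assumes "N \<le> K"
  shows "(\<Sum>k\<le>K. \<Sum>n\<le>N. kernel_weight i j n k * (superset_series (set_decode n) * sierpinski_poly k) $ N)
       = (superset_series (set_decode i) * superset_series (set_decode j)) $ N"
proof -
  let ?I = "set_decode i" and ?J = "set_decode j"
  have "(\<Sum>k\<le>K. \<Sum>n\<le>N. kernel_weight i j n k * (superset_series (set_decode n) * sierpinski_poly k) $ N)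
      = (\<Sum>n\<le>N. (superset_series (set_decode n) *
           (\<Sum>k\<le>K. fps_const (kernel_weight i j n k) * sierpinski_poly k)) $ N)"
    by (subst sum.swap) (simp add: sum_distrib_left fps_sum_nth mult.left_commute[of "superset_series _"])
  also have "\<dots> = (\<Sum>n\<le>N. superset_series (?I \<union> ?J) $ n * superset_series (?I \<inter> ?J) $ (N - n))"
    by (intro sum.cong refl)
       (use assms in \<open>auto simp: sum_kernel_weight_subset_poly fps_X_power_mult_nth superset_series_nth\<close>)
  also have "\<dots> = (superset_series (?I \<union> ?J) * superset_series (?I \<inter> ?J)) $ N"
    by (simp add: fps_mult_nth atMost_atLeast0)
  also have "\<dots> = (superset_series ?I * superset_series ?J) $ N"
    by (simp add: superset_series_mult[of ?I ?J] mult.commute)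
  finally show ?thesis .
qed

text \<open>
  The bilinear expansion in the coefficients of \<open>F\<close> and \<open>G\<close>. It isolates an integer that depends
  on neither \<open>F\<close> nor \<open>G\<close>, so the remaining computation takes place in the integral domain
  \<open>\<int>[[x]]\<close>, where \<open>(1 - x) S_k\<close> can be cancelled.
\<close>

lemma fps_nth_summand:
  fixes F G :: "'a::comm_ring_1 fps"
  shows "(binomial2_transform
            ((fps_map_of_int (fps_bar (sierpinski_delta k)) * fps_X ^ k)
              \<odot> (F * fps_map_of_int (sierpinski_poly k))
              \<odot> (G * fps_map_of_int (sierpinski_poly k)))
          * fps_map_of_int (sierpinski_poly k)) $ N
       = (\<Sum>i\<le>N. \<Sum>j\<le>N. F $ i * G $ j * of_int (\<Sum>n\<le>N. kernel_weight i j n k *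
            (superset_series (set_decode n) * sierpinski_poly k) $ N))"
    (is "(binomial2_transform ?w * _) $ N = _")
proof -
  have delta: "(fps_map_of_int (fps_bar (sierpinski_delta k)) * fps_X ^ k :: 'a fps) $ n
      = of_int (of_bool (set_decode k \<subseteq> set_decode n) * (-1) ^ card (set_decode n - set_decode k))" for n
    using subset_decode_imp_le[of k n]
    by (auto simp: fps_X_power_mult_right_nth fps_map_of_int_def fps_bar_def sierpinski_delta_nth
        thue_morse_set_decode set_decode_diff)
  have w: "?w $ n = (\<Sum>i\<le>N. \<Sum>j\<le>N. F $ i * G $ j * of_int (kernel_weight i j n k))" if "n \<le> N" for n
    unfolding hadamard_def fps_nth_Abs_fps delta fps_nth_mult_sierpinski_poly[OF that] mult.assoc
      sum_product
    unfolding sum_distrib_left kernel_weight_def of_int_mult by (simp only: mult_ac)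
  have "(binomial2_transform ?w * fps_map_of_int (sierpinski_poly k)) $ N
      = (\<Sum>n\<le>N. \<Sum>i\<le>N. \<Sum>j\<le>N. F $ i * G $ j * of_int (kernel_weight i j n k *
            (superset_series (set_decode n) * sierpinski_poly k) $ N))"
    unfolding fps_nth_binomial2_transform_mult
    by (intro sum.cong refl) (simp add: w sum_distrib_right mult.assoc)
  also have "\<dots> = (\<Sum>i\<le>N. \<Sum>n\<le>N. \<Sum>j\<le>N. F $ i * G $ j * of_int (kernel_weight i j n k *
            (superset_series (set_decode n) * sierpinski_poly k) $ N))"
    by (rule sum.swap)
  also have "\<dots> = (\<Sum>i\<le>N. \<Sum>j\<le>N. \<Sum>n\<le>N. F $ i * G $ j * of_int (kernel_weight i j n k *
            (superset_series (set_decode n) * sierpinski_poly k) $ N))"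
    by (intro sum.cong refl sum.swap)
  finally show ?thesis
    by (simp only: of_int_sum sum_distrib_left)
qed

theorem theorem5p4:
  fixes f g :: "'a::comm_ring_1 fps"
  shows "(\<lambda>k. binomial2_transform
              ((fps_map_of_int (fps_bar (sierpinski_delta k)) * fps_X ^ k)
                \<odot> (binomial2_inv_transform f * fps_map_of_int (sierpinski_poly k))
                \<odot> (binomial2_inv_transform g * fps_map_of_int (sierpinski_poly k)))
            * fps_map_of_int (sierpinski_poly k))
         sums (f * g)"
    (is "?t sums _")
  unfolding sums_def_le
proof (rule tendsto_fpsI)
  fix N
  let ?F = "binomial2_inv_transform f" and ?G = "binomial2_inv_transform g"
  let ?c = "\<lambda>i j k. \<Sum>n\<le>N. kernel_weight i j n k * (superset_series (set_decode n) * sierpinski_poly k) $ N"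
  have "(\<Sum>k\<le>K. ?t k) $ N = (f * g) $ N" if "N \<le> K" for K
  proof -
    have "(\<Sum>k\<le>K. ?t k) $ N = (\<Sum>k\<le>K. \<Sum>i\<le>N. \<Sum>j\<le>N. ?F $ i * ?G $ j * of_int (?c i j k))"
      by (simp only: fps_sum_nth fps_nth_summand)
    also have "\<dots> = (\<Sum>i\<le>N. \<Sum>k\<le>K. \<Sum>j\<le>N. ?F $ i * ?G $ j * of_int (?c i j k))"
      by (rule sum.swap)
    also have "\<dots> = (\<Sum>i\<le>N. \<Sum>j\<le>N. \<Sum>k\<le>K. ?F $ i * ?G $ j * of_int (?c i j k))"
      by (intro sum.cong refl sum.swap)
    also have "\<dots> = (\<Sum>i\<le>N. \<Sum>j\<le>N. ?F $ i * ?G $ j *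
        of_int ((superset_series (set_decode i) * superset_series (set_decode j)) $ N))"
      by (simp only: sum_kernel_weight[OF that, symmetric] of_int_sum[of _ "{..K}"] sum_distrib_left)
    also have "\<dots> = (f * g) $ N"
      by (simp only: fps_nth_binomial2_transform_mult_transform[symmetric]
          binomial2_transform_inv_transform)
    finally show ?thesis .
  qed
  then show "\<forall>\<^sub>F K in sequentially. (\<Sum>k\<le>K. ?t k) $ N = (f * g) $ N"
    by (rule eventually_sequentiallyI)
qed

end
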